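(* Let $G$ be the complete bipartite graph $K_{\ell, n-\ell}$ with $2\leq \ell \leq n-1$, and let $2\leq k\leq \ell$. Then $G$ has a Braess clique of order $k$ in the part of order $\ell$ if and only if \[k< \frac{7\ell-3n+2}{5}.\]
   Context: Graphs are finite, simple and undirected. For a connected graph $G$ with at least one edge, the random walk on $G$ has transition matrix $D^{-1}A$ ($A$ adjacency matrix, $D$ diagonal degree matrix), with stationary distribution $w_i=\deg(v_i)/(2|E(G)|)$ and mean first passage times $m_{i,j}$ ($i\ne j$). Kemeny's constant is $\mathcal{K}(G)=\sum_{j\neq i} w_j m_{i,j}$, which is independent of $i$; equivalently $\mathcal{K}(G)=\sum_{j\ge2}\frac{1}{1-\lambda_j}$ over the eigenvalues of $D^{-1}A$ other than the simple eigenvalue $\lambda_1=1$. A Braess clique of order $k$ in a connected graph $G$ is an independent set of $k$ vertices of $G$ such that the graph $\widetilde{G}$ obtained by adding all edges between these $k$ vertices satisfies $\mathcal{K}(\widetilde{G})>\mathcal{K}(G)$; it is in the part of order $\ell$ if all its vertices belong to that part. *)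

theory Defs
  imports Complex_Main "Graph_Theory.Graph_Theory"
begin

text \<open>
  As in the graph library, an undirected simple graph is a symmetric loop-free digraph without
  parallel arcs (\<open>pair_graph\<close>).  Every edge is a pair of opposite arcs, so the degree of a
  vertex is its out-degree, and the number of arcs is twice the number of edges.
\<close>

definition adjacency_matrix :: "'a pair_pre_digraph \<Rightarrow> 'a \<Rightarrow> 'a \<Rightarrow> real" where
  "adjacency_matrix G i j = (if (i, j) \<in> parcs G then 1 else 0)"

definition transition_matrix :: "'a pair_pre_digraph \<Rightarrow> 'a \<Rightarrow> 'a \<Rightarrow> real" where
  "transition_matrix G i j = adjacency_matrix G i j / real (out_degree (with_proj G) i)"

definition stationary_distribution :: "'a pair_pre_digraph \<Rightarrow> 'a \<Rightarrow> real" where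
  "stationary_distribution G i = real (out_degree (with_proj G) i) / real (card (parcs G))"

text \<open>
  The probability that the random walk started at \<open>i\<close> visits \<open>j\<close> at time \<open>t \<ge> 1\<close>, and
  at no time \<open>s\<close> with \<open>1 \<le> s < t\<close>: the sum of the probabilities of the trajectories
  \<open>xs = [x\<^sub>0, \<dots>, x\<^sub>t]\<close> with \<open>x\<^sub>0 = i\<close>, \<open>x\<^sub>t = j\<close> and \<open>j \<notin> {x\<^sub>1, \<dots>, x\<^sub>t\<^sub>-\<^sub>1}\<close>.
\<close>

definition first_passage_prob :: "'a pair_pre_digraph \<Rightarrow> nat \<Rightarrow> 'a \<Rightarrow> 'a \<Rightarrow> real" where
  "first_passage_prob G t i j =
     (\<Sum>xs | set xs \<subseteq> pverts G \<and> length xs = Suc t \<and> hd xs = i \<and> last xs = j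
             \<and> j \<notin> set (butlast (tl xs)).
        \<Prod>s<t. transition_matrix G (xs ! s) (xs ! Suc s))"

text \<open>
  The expectation of the first passage time.  In a finite connected graph the passage time
  is almost surely finite and the series converges.
\<close>

definition mean_first_passage_time :: "'a pair_pre_digraph \<Rightarrow> 'a \<Rightarrow> 'a \<Rightarrow> real" where
  "mean_first_passage_time G i j = (\<Sum>t. real t * first_passage_prob G t i j)"

text \<open>
  The common value, over all starting vertices \<open>i\<close>, of the mean time to reach a target drawn
  from the stationary distribution (the target \<open>i\<close> itself contributing nothing).
  Meaningful for connected graphs with at least one edge.
\<close>

definition kemeny_constant :: "'a pair_pre_digraph \<Rightarrow> real" where
  "kemeny_constant G =
     (THE c. \<forall>i \<in> pverts G.
        c = (\<Sum>j \<in> pverts G - {i}. stationary_distribution G j * mean_first_passage_time G i j))"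

definition independent_set :: "'a pair_pre_digraph \<Rightarrow> 'a set \<Rightarrow> bool" where
  "independent_set G S \<longleftrightarrow> S \<subseteq> pverts G \<and> (\<forall>u \<in> S. \<forall>v \<in> S. (u, v) \<notin> parcs G)"

definition add_clique :: "'a pair_pre_digraph \<Rightarrow> 'a set \<Rightarrow> 'a pair_pre_digraph" where
  "add_clique G S = G \<lparr> parcs := parcs G \<union> {(u, v). u \<in> S \<and> v \<in> S \<and> u \<noteq> v} \<rparr>"

definition braess_clique :: "'a pair_pre_digraph \<Rightarrow> nat \<Rightarrow> 'a set \<Rightarrow> bool" where
  "braess_clique G k S \<longleftrightarrow>
     pair_graph G \<and> connected (with_proj G) \<and> independent_set G S \<and> card S = k
     \<and> kemeny_constant (add_clique G S) > kemeny_constant G"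

definition bipartition :: "'a pair_pre_digraph \<Rightarrow> 'a set \<Rightarrow> 'a set \<Rightarrow> bool" where
  "bipartition G U V \<longleftrightarrow>
     pverts G = U \<union> V \<and> U \<inter> V = {} \<and> parcs G \<subseteq> U \<times> V \<union> V \<times> U"

end

theory Submission
  imports Defs
begin

text \<open>
  Adding a clique on \<open>S \<subseteq> U\<close> to the complete bipartite graph with parts \<open>U\<close> and \<open>V\<close> makes the
  partition into \<open>S\<close>, \<open>U - S\<close> and \<open>V\<close> equitable, so the expected hitting times of a vertex are
  constant on these classes (away from the target) and solve a linear system of size at most three.
  With \<open>k = |S|\<close>, \<open>l = |U|\<close> and \<open>m = |V|\<close> this gives Kemeny's constant
  \<open>l + m - 3 - (k - 1) / (k + m) + l (3 m + 2 k - 2) / (2 m l + k (k - 1))\<close>.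
  The original graph is the case \<open>k = 1\<close>, because a clique on one vertex adds no edge; the
  difference of the two values is a positive multiple of \<open>k (k - 1) (4 l + 2 - 3 m - 5 k)\<close>.
\<close>

section \<open>Mean first passage times\<close>

text \<open>The kernel of the walk killed at \<open>j\<close>, acting on functions: its n-th iterate
  at the constant 1 is the probability of avoiding \<open>j\<close> at the times 1 to n.\<close>

definition killed_step :: "'a pair_pre_digraph \<Rightarrow> 'a \<Rightarrow> ('a \<Rightarrow> real) \<Rightarrow> 'a \<Rightarrow> real" where
  "killed_step G j f i = (\<Sum>x \<in> pverts G - {j}. transition_matrix G i x * f x)"

lemma killed_step_cong:
  "(\<And>x. x \<in> pverts G - {j} \<Longrightarrow> f x = g x) \<Longrightarrow> killed_step G j f i = killed_step G j g i"
  unfolding killed_step_def by (rule sum.cong) auto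

lemma killed_step_mono:
  "(\<And>x. x \<in> pverts G - {j} \<Longrightarrow> f x \<le> g x) \<Longrightarrow> killed_step G j f i \<le> killed_step G j g i"
  unfolding killed_step_def
  by (intro sum_mono mult_left_mono) (auto simp: transition_matrix_def adjacency_matrix_def)

lemma killed_step_diff:
  "killed_step G j (\<lambda>x. f x - g x) i = killed_step G j f i - killed_step G j g i"
  unfolding killed_step_def by (simp add: right_diff_distrib sum_subtractf)

lemma killed_step_scale:
  "killed_step G j (\<lambda>x. c * f x) i = c * killed_step G j f i"
  unfolding killed_step_def by (simp add: sum_distrib_left mult.left_commute)

lemma killed_step_nonneg:
  "(\<And>x. x \<in> pverts G - {j} \<Longrightarrow> 0 \<le> f x) \<Longrightarrow> 0 \<le> killed_step G j f i"
  using killed_step_mono[of G j "\<lambda>_. 0" f i] by (simp add: killed_step_def)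

lemma first_passage_prob_one:
  assumes "i \<in> pverts G" "j \<in> pverts G"
  shows "first_passage_prob G 1 i j = transition_matrix G i j"
proof -
  have "{xs. set xs \<subseteq> pverts G \<and> length xs = Suc 1 \<and> hd xs = i \<and> last xs = j
          \<and> j \<notin> set (butlast (tl xs))} = {[i, j]}"
    using assms by (auto simp: length_Suc_conv)
  then show ?thesis
    unfolding first_passage_prob_def by simp
qed

text \<open>Condition on the first step: a trajectory with at least two steps cannot be at
  \<open>j\<close> at time 1, so deleting its first vertex leaves a first passage trajectory from
  some \<open>x\<close> other than \<open>j\<close>.\<close>

lemma first_passage_prob_Suc_Suc:
  assumes "finite (pverts G)" "i \<in> pverts G"
  shows "first_passage_prob G (Suc (Suc t)) i j
    = killed_step G j (\<lambda>x. first_passage_prob G (Suc t) x j) i"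
proof -
  define B where "B x = {ys. set ys \<subseteq> pverts G \<and> length ys = Suc (Suc t) \<and> hd ys = x
    \<and> last ys = j \<and> j \<notin> set (butlast (tl ys))}" for x
  define w where "w xs = (\<Prod>s<length xs - 1. transition_matrix G (xs ! s) (xs ! Suc s))" for xs
  have fin: "finite (B x)" for x
    using finite_lists_length_eq[OF assms(1), of "Suc (Suc t)"]
    by (rule rev_finite_subset) (auto simp: B_def)
  have "{xs. set xs \<subseteq> pverts G \<and> length xs = Suc (Suc (Suc t)) \<and> hd xs = i \<and> last xs = j
          \<and> j \<notin> set (butlast (tl xs))} = Cons i ` (\<Union>x \<in> pverts G - {j}. B x)"
    (is "?L = ?R")
  proof (intro equalityI subsetI)
    fix xs assume xs: "xs \<in> ?L"
    \<comment> \<open>The third entry \<open>y\<close> puts \<open>x\<close> into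
      \<open>butlast (tl xs)\<close>, which is why \<open>x\<close> differs from
      \<open>j\<close>.\<close>
    then obtain x y zs where "xs = i # x # y # zs"
      by (auto simp: length_Suc_conv)
    with xs show "xs \<in> ?R"
      by (auto simp: B_def image_iff)
  next
    fix xs assume "xs \<in> ?R"
    then obtain x ys where "xs = i # ys" "x \<in> pverts G - {j}" "ys \<in> B x"
      by auto
    moreover from this obtain y zs where "ys = x # y # zs"
      by (auto simp: B_def length_Suc_conv)
    ultimately show "xs \<in> ?L"
      using assms(2) by (auto simp: B_def)
  qed
  then have "first_passage_prob G (Suc (Suc t)) i j
      = (\<Sum>xs \<in> Cons i ` (\<Union>x \<in> pverts G - {j}. B x).
          \<Prod>s<Suc (Suc t). transition_matrix G (xs ! s) (xs ! Suc s))"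
    unfolding first_passage_prob_def by (rule arg_cong)
  also have "\<dots> = (\<Sum>ys \<in> (\<Union>x \<in> pverts G - {j}. B x).
          \<Prod>s<Suc (Suc t). transition_matrix G ((i # ys) ! s) ((i # ys) ! Suc s))"
    by (subst sum.reindex) auto
  also have "\<dots> = (\<Sum>x \<in> pverts G - {j}. \<Sum>ys \<in> B x.
          \<Prod>s<Suc (Suc t). transition_matrix G ((i # ys) ! s) ((i # ys) ! Suc s))"
    using assms(1) fin by (intro sum.UNION_disjoint) (auto simp: B_def)
  also have "\<dots> = (\<Sum>x \<in> pverts G - {j}. \<Sum>ys \<in> B x. transition_matrix G i x *
          (\<Prod>s<Suc t. transition_matrix G (ys ! s) (ys ! Suc s)))"
  proof (intro sum.cong refl)
    fix x ys assume "ys \<in> B x"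
    then have "ys ! 0 = x"
      by (cases ys) (auto simp: B_def)
    then show "(\<Prod>s<Suc (Suc t). transition_matrix G ((i # ys) ! s) ((i # ys) ! Suc s))
        = transition_matrix G i x * (\<Prod>s<Suc t. transition_matrix G (ys ! s) (ys ! Suc s))"
      by (subst prod.lessThan_Suc_shift) simp
  qed
  also have "\<dots> = killed_step G j (\<lambda>x. first_passage_prob G (Suc t) x j) i"
    unfolding killed_step_def first_passage_prob_def B_def by (simp add: sum_distrib_left)
  finally show ?thesis .
qed

lemma out_degree_with_proj: "out_degree (with_proj G) i = card {x. (i, x) \<in> parcs G}"
proof -
  have "out_arcs (with_proj G) i = Pair i ` {x. (i, x) \<in> parcs G}"
    by (auto simp: out_arcs_def)
  then show ?thesis
    by (simp add: out_degree_def card_image inj_on_def)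
qed

text \<open>Reduces hitting time equations to counting neighbours: a killed step is the mean over
  the neighbours of \<open>i\<close>, with the value at \<open>j\<close> replaced by 0.\<close>

lemma killed_step_eq_neighbours:
  assumes "finite (pverts G)" "parcs G \<subseteq> pverts G \<times> pverts G"
  shows "killed_step G j f i
    = (\<Sum>x \<in> {x. (i, x) \<in> parcs G} - {j}. f x) / real (card {x. (i, x) \<in> parcs G})"
proof -
  have "killed_step G j f i = (\<Sum>x \<in> pverts G - {j}.
      if (i, x) \<in> parcs G then f x / real (card {x. (i, x) \<in> parcs G}) else 0)"
    unfolding killed_step_def transition_matrix_def adjacency_matrix_def out_degree_with_proj
    by (rule sum.cong) auto
  also have "\<dots> = (\<Sum>x \<in> {x \<in> pverts G - {j}. (i, x) \<in> parcs G}.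
      f x / real (card {x. (i, x) \<in> parcs G}))"
    using assms(1) by (intro sum.inter_filter[symmetric]) simp
  also have "{x \<in> pverts G - {j}. (i, x) \<in> parcs G} = {x. (i, x) \<in> parcs G} - {j}"
    using assms(2) by auto
  finally show ?thesis
    by (simp add: sum_divide_distrib)
qed

text \<open>The probabilities out of a vertex with a neighbour sum to 1, and only the step into
  \<open>j\<close> is lost.\<close>

lemma killed_step_one:
  assumes "finite (pverts G)" "parcs G \<subseteq> pverts G \<times> pverts G"
    and "{x. (i, x) \<in> parcs G} \<noteq> {}"
  shows "killed_step G j (\<lambda>_. 1) i = 1 - transition_matrix G i j"
proof -
  have fin: "finite {x. (i, x) \<in> parcs G}"
    by (rule finite_subset[OF _ assms(1)]) (use assms(2) in auto)
  then have pos: "card {x. (i, x) \<in> parcs G} > 0"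
    using assms(3) by (simp add: card_gt_0_iff)
  show ?thesis
    using pos fin assms(3)
    by (auto simp: killed_step_eq_neighbours[OF assms(1,2)] transition_matrix_def
        adjacency_matrix_def out_degree_with_proj of_nat_diff field_simps)
qed

text \<open>
  With \<open>M\<close> an upper bound of \<open>h\<close>, the equation gives \<open>Q h = h - 1 \<le> (1 - 1 / M) h\<close> for the
  killed kernel \<open>Q\<close>, so \<open>Q\<^sup>n h\<close> and the survival probabilities \<open>Q\<^sup>n 1\<close> decay geometrically.
  Hence a nonnegative solution is the hitting time, and reachability of \<open>j\<close> need not be assumed.
\<close>

lemma mean_first_passage_time_eqI:
  assumes fin: "finite (pverts G)" and wf: "parcs G \<subseteq> pverts G \<times> pverts G"
    and deg: "\<And>x. x \<in> pverts G - {j} \<Longrightarrow> {y. (x, y) \<in> parcs G} \<noteq> {}"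
    and h: "\<And>x. x \<in> pverts G - {j} \<Longrightarrow> h x = 1 + killed_step G j h x"
    and h_nonneg: "\<And>x. x \<in> pverts G - {j} \<Longrightarrow> 0 \<le> h x"
    and j: "j \<in> pverts G" and i: "i \<in> pverts G - {j}"
  shows "mean_first_passage_time G i j = h i"
proof -
  let ?Q = "killed_step G j" and ?V = "pverts G - {j}"
  \<comment> \<open>\<open>A n x\<close> is the chance of avoiding \<open>j\<close> for n steps. Off
    \<open>j\<close>, \<open>B n - B (n + 1) = A n\<close>, so \<open>B n\<close> acts as the tail
    sum of the \<open>A\<close>.\<close>
  define A where "A n = (?Q ^^ n) (\<lambda>_. 1)" for n
  define B where "B n = (?Q ^^ n) h" for n
  have A0: "A 0 x = 1" and AS: "A (Suc n) x = ?Q (A n) x" for n x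
    by (simp_all add: A_def)
  have B0: "B 0 x = h x" and BS: "B (Suc n) = ?Q (B n)" for n x
    by (simp_all add: B_def)
  \<comment> \<open>First passage at time n + 1 is survival for n steps but not for n + 1.\<close>
  have first_passage: "first_passage_prob G (Suc n) x j = A n x - A (Suc n) x"
    if "x \<in> ?V" for n x
    using that
  proof (induction n arbitrary: x)
    case 0
    then show ?case
      using first_passage_prob_one[of x G j] killed_step_one[OF fin wf deg[OF 0]] j
      by (simp add: A_def)
  next
    case (Suc n)
    have "first_passage_prob G (Suc (Suc n)) x j = ?Q (\<lambda>x. A n x - A (Suc n) x) x"
      using Suc by (subst first_passage_prob_Suc_Suc[OF fin]) (auto intro: killed_step_cong)
    then show ?case
      by (simp add: killed_step_diff AS[symmetric])
  qed
  \<comment> \<open>This is the equation h - Q h = 1 after n applications of Q.\<close>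
  have B_step: "B n x - B (Suc n) x = A n x" if "x \<in> ?V" for n x
    using that
  proof (induction n arbitrary: x)
    case 0
    then show ?case
      using h[of x] by (simp add: A_def B_def)
  next
    case (Suc n)
    have "B (Suc n) x - B (Suc (Suc n)) x = ?Q (\<lambda>y. B n y - B (Suc n) y) x"
      by (simp add: killed_step_diff BS)
    also have "\<dots> = A (Suc n) x"
      using Suc.IH by (simp only: AS) (rule killed_step_cong)
    finally show ?case .
  qed
  have A_nonneg: "0 \<le> A n x" for n x
    by (induction n arbitrary: x) (auto simp: A0 AS intro: killed_step_nonneg)
  have B_nonneg: "0 \<le> B n x" if "x \<in> ?V" for n x
    using that
  proof (induction n arbitrary: x)
    case (Suc n)
    then show ?case unfolding BS by (intro killed_step_nonneg) auto
  qed (use h_nonneg in \<open>auto simp: B0\<close>)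
  have A_le_B: "A n x \<le> B n x" if "x \<in> ?V" for n x
    using B_step[OF that, of n] B_nonneg[OF that, of "Suc n"] by linarith
  define M where "M = Max (h ` ?V)"
  have le_M: "h x \<le> M" if "x \<in> ?V" for x
    using fin that by (auto simp: M_def)
  \<comment> \<open>At n = 0 the bound \<open>A_le_B\<close> reads 1 \<le> h, so the contraction
    factor c = 1 - 1 / M lies in [0, 1).\<close>
  have M: "1 \<le> M"
    using le_M[OF i] A_le_B[OF i, of 0] by (simp add: A0 B0)
  define c where "c = 1 - 1 / M"
  have c: "0 \<le> c" "c < 1"
    using M by (auto simp: c_def)
  have h_contract: "h x - 1 \<le> c * h x" if "x \<in> ?V" for x
    using le_M[OF that] M by (simp add: c_def field_simps)
  have B_le: "B n x \<le> c ^ n * h x" if "x \<in> ?V" for n x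
    using that
  proof (induction n arbitrary: x)
    case (Suc n)
    have "B (Suc n) x \<le> ?Q (\<lambda>x. c ^ n * h x) x"
      using Suc.IH unfolding BS by (rule killed_step_mono)
    also have "\<dots> = c ^ n * (h x - 1)"
      using h[OF Suc.prems] by (simp add: killed_step_scale)
    also have "\<dots> \<le> c ^ n * (c * h x)"
      using h_contract[OF Suc.prems] c by (intro mult_left_mono) auto
    finally show ?case by (simp add: mult_ac)
  qed (simp add: B0)
  \<comment> \<open>Summation by parts leaves \<open>h i\<close> minus two remainders, both of which
    tend to 0.\<close>
  have partial: "(\<Sum>n<N. real (Suc n) * first_passage_prob G (Suc n) i j)
      = h i - B N i - real N * A N i" for N
  proof (induction N)
    case (Suc N)
    show ?case
      unfolding sum.lessThan_Suc Suc.IH unfolding first_passage[OF i]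
      using B_step[OF i, of N] by (simp add: algebra_simps)
  qed (simp add: B0)
  have lim_c: "(\<lambda>n. c ^ n * h i) \<longlonglongrightarrow> 0"
    using c by (intro tendsto_mult_left_zero LIMSEQ_realpow_zero)
  have lim_nc: "(\<lambda>n. real n * c ^ n * h i) \<longlonglongrightarrow> 0"
    using c by (intro tendsto_mult_left_zero powser_times_n_limit_0) auto
  have lim_B: "(\<lambda>n. B n i) \<longlonglongrightarrow> 0"
    by (rule tendsto_sandwich[OF _ _ tendsto_const lim_c]) (use B_nonneg B_le i in auto)
  have "real n * A n i \<le> real n * (c ^ n * h i)" for n
    using A_le_B[OF i, of n] B_le[OF i, of n] by (intro mult_left_mono) auto
  then have lim_A: "(\<lambda>n. real n * A n i) \<longlonglongrightarrow> 0"
    by (intro tendsto_sandwich[OF _ _ tendsto_const lim_nc])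
      (auto simp: A_nonneg mult.assoc intro!: always_eventually)
  have "(\<lambda>n. real (Suc n) * first_passage_prob G (Suc n) i j) sums h i"
    unfolding sums_def partial using tendsto_diff[OF tendsto_diff[OF tendsto_const lim_B] lim_A]
    by simp
  \<comment> \<open>Shifting the index costs nothing, because the term at t = 0 carries the factor
    0.\<close>
  then have "(\<lambda>t. real t * first_passage_prob G t i j) sums h i"
    by (subst (asm) sums_Suc_iff) simp
  then show ?thesis
    unfolding mean_first_passage_time_def by (simp add: sums_iff)
qed

text \<open>A vertex makes the description \<open>THE c\<close> unique: with no vertices, every c
  would satisfy it.\<close>

lemma kemeny_constant_eqI:
  assumes "pverts G \<noteq> {}"
    and "\<And>i. i \<in> pverts G \<Longrightarrow>
      (\<Sum>j \<in> pverts G - {i}. stationary_distribution G j * mean_first_passage_time G i j) = c"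
  shows "kemeny_constant G = c"
  unfolding kemeny_constant_def using assms by (intro the_equality) auto

section \<open>Complete bipartite graphs with an added clique\<close>

text \<open>\<open>T\<close> may be empty, which is the case of a clique filling its part; a
  one-element \<open>S\<close> gives the complete bipartite graph itself.\<close>

locale bipartite_clique =
  fixes H :: "'a pair_pre_digraph" and S T V :: "'a set"
  assumes finite_parts: "finite S" "finite T" "finite V"
    and disjoint_parts: "S \<inter> T = {}" "S \<inter> V = {}" "T \<inter> V = {}"
    and nonempty_parts: "S \<noteq> {}" "V \<noteq> {}"
    and pverts_eq: "pverts H = S \<union> T \<union> V"
    and parcs_eq: "parcs H =
      (S \<union> T) \<times> V \<union> V \<times> (S \<union> T) \<union> {(u, v). u \<in> S \<and> v \<in> S \<and> u \<noteq> v}"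
begin

abbreviation s where "s \<equiv> real (card S)"
abbreviation t where "t \<equiv> real (card T)"
abbreviation m where "m \<equiv> real (card V)"
text \<open>The total degree, as \<open>card_parcs\<close> proves.\<close>

abbreviation vol where "vol \<equiv> 2 * m * (s + t) + s * (s - 1)"

lemma s_ge_1: "1 \<le> s" and m_ge_1: "1 \<le> m"
proof -
  have "1 \<le> card S" "1 \<le> card V"
    using finite_parts nonempty_parts by (simp_all add: Suc_le_eq card_gt_0_iff)
  then show "1 \<le> s" "1 \<le> m" by simp_all
qed

lemma vol_pos: "0 < vol"
  using s_ge_1 m_ge_1 by (intro add_pos_nonneg mult_pos_pos mult_nonneg_nonneg) auto

lemma finite_pverts: "finite (pverts H)"
  using finite_parts by (simp add: pverts_eq)

lemma parcs_subset: "parcs H \<subseteq> pverts H \<times> pverts H"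
  by (auto simp: parcs_eq pverts_eq)

lemma neighbours_S: "x \<in> S \<Longrightarrow> {y. (x, y) \<in> parcs H} = (S - {x}) \<union> V"
  and neighbours_T: "x \<in> T \<Longrightarrow> {y. (x, y) \<in> parcs H} = V"
  and neighbours_V: "x \<in> V \<Longrightarrow> {y. (x, y) \<in> parcs H} = S \<union> T"
  using disjoint_parts by (auto simp: parcs_eq)

lemma neighbours_nonempty: "x \<in> pverts H \<Longrightarrow> {y. (x, y) \<in> parcs H} \<noteq> {}"
  using nonempty_parts by (auto simp: pverts_eq parcs_eq)

text \<open>Keeps counts such as |S - {j}| in the reals, where subtraction is not truncated.\<close>

lemma real_card_Diff_singleton:
  assumes "finite A"
  shows "real (card (A - {x})) = real (card A) - (if x \<in> A then 1 else 0)"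
proof (cases "x \<in> A")
  case True
  then have "1 \<le> card A"
    using assms by (auto simp: Suc_le_eq card_gt_0_iff)
  with True show ?thesis
    by (simp add: of_nat_diff)
qed simp

lemma degree_S: "x \<in> S \<Longrightarrow> real (card {y. (x, y) \<in> parcs H}) = m + s - 1"
  and degree_T: "x \<in> T \<Longrightarrow> real (card {y. (x, y) \<in> parcs H}) = m"
  and degree_V: "x \<in> V \<Longrightarrow> real (card {y. (x, y) \<in> parcs H}) = s + t"
proof -
  assume "x \<in> S"
  moreover have "card ((S - {x}) \<union> V) = card (S - {x}) + card V"
    using finite_parts disjoint_parts by (intro card_Un_disjoint) auto
  ultimately show "real (card {y. (x, y) \<in> parcs H}) = m + s - 1"
    using finite_parts by (simp add: neighbours_S real_card_Diff_singleton del: card_Diff_insert)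
next
  assume "x \<in> V"
  then show "real (card {y. (x, y) \<in> parcs H}) = s + t"
    using finite_parts disjoint_parts by (simp add: neighbours_V card_Un_disjoint)
qed (simp add: neighbours_T)

lemma card_parcs: "real (card (parcs H)) = vol"
proof -
  have "parcs H = Sigma (pverts H) (\<lambda>x. {y. (x, y) \<in> parcs H})"
    using parcs_subset by auto
  moreover have "finite {y. (x, y) \<in> parcs H}" for x
    by (rule finite_subset[OF _ finite_pverts]) (use parcs_subset in auto)
  ultimately have "card (parcs H) = (\<Sum>x \<in> pverts H. card {y. (x, y) \<in> parcs H})"
    using finite_pverts card_SigmaI[of "pverts H" "\<lambda>x. {y. (x, y) \<in> parcs H}"] by metis
  then have "real (card (parcs H)) = (\<Sum>x \<in> S \<union> T \<union> V. real (card {y. (x, y) \<in> parcs H}))"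
    by (simp add: pverts_eq)
  also have "\<dots> = (\<Sum>x \<in> S. m + s - 1) + (\<Sum>x \<in> T. m) + (\<Sum>x \<in> V. s + t)"
    using finite_parts disjoint_parts
    by (subst sum.union_disjoint, simp, simp, blast)+
      (simp add: degree_S degree_T degree_V)
  also have "\<dots> = vol"
    by (simp add: algebra_simps)
  finally show ?thesis .
qed

section \<open>Functions constant on the three classes\<close>

text \<open>The value at the target is a dummy: \<open>killed_step\<close> skips it, and the hitting
  time equation is imposed only elsewhere.\<close>

definition class_fun :: "real \<Rightarrow> real \<Rightarrow> real \<Rightarrow> 'a \<Rightarrow> real" where
  "class_fun a b c x = (if x \<in> S then a else if x \<in> T then b else c)"

lemma class_fun_simps:
  "x \<in> S \<Longrightarrow> class_fun a b c x = a"
  "x \<in> T \<Longrightarrow> class_fun a b c x = b"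
  "x \<in> V \<Longrightarrow> class_fun a b c x = c"
  using disjoint_parts by (auto simp: class_fun_def)

lemma killed_step_S:
  assumes "x \<in> S"
  shows "killed_step H j (class_fun a b c) x
    = (real (card (S - {x} - {j})) * a + real (card (V - {j})) * c) / (m + s - 1)"
proof -
  have "(\<Sum>y \<in> {y. (x, y) \<in> parcs H} - {j}. class_fun a b c y)
      = (\<Sum>y \<in> (S - {x} - {j}) \<union> (V - {j}). class_fun a b c y)"
    by (rule sum.cong) (auto simp: neighbours_S[OF assms])
  also have "\<dots> = (\<Sum>y \<in> S - {x} - {j}. a) + (\<Sum>y \<in> V - {j}. c)"
    using finite_parts disjoint_parts
    by (subst sum.union_disjoint) (auto simp: class_fun_simps intro!: arg_cong2[of _ _ _ _ "(+)"] sum.cong)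
  finally show ?thesis
    by (simp add: killed_step_eq_neighbours[OF finite_pverts parcs_subset] degree_S[OF assms])
qed

lemma killed_step_T:
  assumes "x \<in> T"
  shows "killed_step H j (class_fun a b c) x = real (card (V - {j})) * c / m"
proof -
  have "(\<Sum>y \<in> {y. (x, y) \<in> parcs H} - {j}. class_fun a b c y) = (\<Sum>y \<in> V - {j}. c)"
    by (rule sum.cong) (auto simp: neighbours_T[OF assms] class_fun_simps)
  then show ?thesis
    by (simp add: killed_step_eq_neighbours[OF finite_pverts parcs_subset] degree_T[OF assms])
qed

lemma killed_step_V:
  assumes "x \<in> V"
  shows "killed_step H j (class_fun a b c) x
    = (real (card (S - {j})) * a + real (card (T - {j})) * b) / (s + t)"
proof -
  have "(\<Sum>y \<in> {y. (x, y) \<in> parcs H} - {j}. class_fun a b c y)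
      = (\<Sum>y \<in> (S - {j}) \<union> (T - {j}). class_fun a b c y)"
    by (rule sum.cong) (auto simp: neighbours_V[OF assms])
  also have "\<dots> = (\<Sum>y \<in> S - {j}. a) + (\<Sum>y \<in> T - {j}. b)"
    using finite_parts disjoint_parts
    by (subst sum.union_disjoint) (auto simp: class_fun_simps intro!: arg_cong2[of _ _ _ _ "(+)"] sum.cong)
  finally show ?thesis
    by (simp add: killed_step_eq_neighbours[OF finite_pverts parcs_subset] degree_V[OF assms])
qed

text \<open>A whole hitting time function comes from at most three scalar equations. A class with no
  vertex other than \<open>j\<close> imposes none, and its value only has to be nonnegative.\<close>

lemma mean_first_passage_time_class_fun:
  assumes "j \<in> pverts H" "i \<in> pverts H - {j}"
    and "0 \<le> a" "0 \<le> b" "0 \<le> c"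
    and "\<And>x. x \<in> S - {j} \<Longrightarrow> a = 1 + killed_step H j (class_fun a b c) x"
    and "\<And>x. x \<in> T - {j} \<Longrightarrow> b = 1 + killed_step H j (class_fun a b c) x"
    and "\<And>x. x \<in> V - {j} \<Longrightarrow> c = 1 + killed_step H j (class_fun a b c) x"
  shows "mean_first_passage_time H i j = class_fun a b c i"
proof (rule mean_first_passage_time_eqI[OF finite_pverts parcs_subset _ _ _ assms(1,2)])
  show "{y. (x, y) \<in> parcs H} \<noteq> {}" if "x \<in> pverts H - {j}" for x
    using that neighbours_nonempty by blast
  show "class_fun a b c x = 1 + killed_step H j (class_fun a b c) x" if "x \<in> pverts H - {j}" for x
    using that assms(6-8)[of x] by (auto simp: pverts_eq class_fun_simps)
  show "0 \<le> class_fun a b c x" for x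
    using assms(3-5) by (simp add: class_fun_def)
qed

lemmas card_parts_Diff = real_card_Diff_singleton[OF finite_parts(1)]
  real_card_Diff_singleton[OF finite_parts(2)] real_card_Diff_singleton[OF finite_parts(3)]
  real_card_Diff_singleton[OF finite_Diff[OF finite_parts(1)]]

section \<open>Hitting times for a target in each class\<close>

text \<open>
  \<open>hit_A_B\<close> is the expected time from a vertex of \<open>A\<close> to another vertex of \<open>B\<close>.  The times
  that are missing here are \<open>vol / (s + t)\<close> within \<open>V\<close>; one more than the time from \<open>V\<close>
  for walks from \<open>T\<close> to \<open>S\<close> or \<open>T\<close>, since the first step from \<open>T\<close> leads to \<open>V\<close>; and
  \<open>hit_V_T + (m + s - 1) / m\<close> from \<open>S\<close> to \<open>T\<close>, the extra term being the mean exit time from \<open>S\<close>.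
\<close>

definition "hit_S_S = vol / (s + m)"
definition "hit_V_S = (s + 2 * t + (s - 1) * hit_S_S) / s"
definition "hit_V_T = s + 2 * t - 1 + s * (m + s - 1) / m"
definition "hit_S_V = (m + s - 1 + (m - 1) * (vol / (s + t))) / m"
definition "hit_T_V = 1 + (m - 1) / m * (vol / (s + t))"

text \<open>Two vertices of \<open>S\<close> have the same closed neighbourhood, so with d = m + s -
  1 the return time vol / d of the target is (1 + 1 / d) times \<open>hit_S_S\<close>. This explains
  the denominator s + m.\<close>

lemma mean_first_passage_time_S:
  assumes "j \<in> S" "i \<in> pverts H - {j}"
  shows "mean_first_passage_time H i j = class_fun hit_S_S (1 + hit_V_S) hit_V_S i"
proof (rule mean_first_passage_time_class_fun)
  have pos: "0 < s" "0 < m" "0 < s + m" "0 < m + s - 1" "0 < s + t"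
    using s_ge_1 m_ge_1 by auto
  note jm = assms(1) disjoint_parts
  show "j \<in> pverts H" "i \<in> pverts H - {j}"
    using assms by (auto simp: pverts_eq)
  show S0: "0 \<le> hit_S_S"
    using vol_pos pos by (simp add: hit_S_S_def)
  show V0: "0 \<le> hit_V_S"
    using S0 s_ge_1 by (simp add: hit_V_S_def)
  then show "0 \<le> 1 + hit_V_S" by simp
  have *: "s * hit_V_S = s + 2 * t + (s - 1) * hit_S_S"
    using pos by (simp add: hit_V_S_def)
  have **: "(s + m) * hit_S_S = vol"
    using pos by (simp add: hit_S_S_def)
  show "hit_S_S = 1 + killed_step H j (class_fun hit_S_S (1 + hit_V_S) hit_V_S) x"
    if x: "x \<in> S - {j}" for x
  proof -
    have c: "real (card (S - {x} - {j})) = s - 2" "real (card (V - {j})) = m"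
      using jm x unfolding card_parts_Diff by auto
    \<comment> \<open>\<open>algebra\<close> knows \<open>hit_V_S\<close> only through its multiple
      by s, hence the extra factor.\<close>
    have "s * ((m + 1) * hit_S_S) = s * (m + s - 1 + m * hit_V_S)"
      using * ** by algebra
    then have "(m + 1) * hit_S_S = m + s - 1 + m * hit_V_S"
      using pos by simp
    then show ?thesis
      using x pos by (simp add: killed_step_S c field_simps del: card_Diff_insert)
  qed
  show "1 + hit_V_S = 1 + killed_step H j (class_fun hit_S_S (1 + hit_V_S) hit_V_S) x"
    if x: "x \<in> T - {j}" for x
  proof -
    have "real (card (V - {j})) = m"
      using jm unfolding card_parts_Diff by auto
    then show ?thesis
      using x pos by (simp add: killed_step_T)
  qed
  show "hit_V_S = 1 + killed_step H j (class_fun hit_S_S (1 + hit_V_S) hit_V_S) x"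
    if x: "x \<in> V - {j}" for x
  proof -
    have c: "real (card (S - {j})) = s - 1" "real (card (T - {j})) = t"
      using jm unfolding card_parts_Diff by auto
    show ?thesis
      using x pos * by (simp add: killed_step_V c field_simps)
  qed
qed

text \<open>From \<open>V\<close> the target is hit in one step with probability 1 / (s + t);
  otherwise the walk is back in \<open>V\<close> after one more step from \<open>T\<close>, or a
  mean of (m + s - 1) / m steps from \<open>S\<close>. So \<open>hit_V_T\<close> is the only real
  unknown.\<close>

lemma mean_first_passage_time_T:
  assumes "j \<in> T" "i \<in> pverts H - {j}"
  shows "mean_first_passage_time H i j
    = class_fun (hit_V_T + (m + s - 1) / m) (1 + hit_V_T) hit_V_T i"
proof (rule mean_first_passage_time_class_fun)
  have pos: "0 < s" "0 < m" "0 < s + m" "0 < m + s - 1" "0 < s + t"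
    using s_ge_1 m_ge_1 by auto
  note jm = assms(1) disjoint_parts
  show "j \<in> pverts H" "i \<in> pverts H - {j}"
    using assms by (auto simp: pverts_eq)
  show V0: "0 \<le> hit_V_T"
    using pos s_ge_1 by (simp add: hit_V_T_def)
  then show "0 \<le> 1 + hit_V_T" "0 \<le> hit_V_T + (m + s - 1) / m"
    using pos by auto
  have *: "m * hit_V_T = m * (s + 2 * t - 1) + s * (m + s - 1)"
    using pos by (simp add: hit_V_T_def field_simps)
  let ?f = "class_fun (hit_V_T + (m + s - 1) / m) (1 + hit_V_T) hit_V_T"
  show "hit_V_T + (m + s - 1) / m = 1 + killed_step H j ?f x" if x: "x \<in> S - {j}" for x
  proof -
    have c: "real (card (S - {x} - {j})) = s - 1" "real (card (V - {j})) = m"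
      using jm x unfolding card_parts_Diff by auto
    \<comment> \<open>Naming the quotient keeps \<open>algebra\<close> free of division, here and in
      the equation at \<open>V\<close>.\<close>
    define e where "e = (m + s - 1) / m"
    have "m * e = m + s - 1"
      using pos by (simp add: e_def)
    then have "(hit_V_T + e) * (m + s - 1) = m + s - 1 + ((s - 1) * (hit_V_T + e) + m * hit_V_T)"
      by algebra
    then have "hit_V_T + e - 1 = ((s - 1) * (hit_V_T + e) + m * hit_V_T) / (m + s - 1)"
      using pos by (simp only: eq_divide_eq left_diff_distrib) simp
    then show ?thesis
      unfolding e_def[symmetric] killed_step_S[OF DiffD1[OF x]] c by linarith
  qed
  show "1 + hit_V_T = 1 + killed_step H j ?f x" if x: "x \<in> T - {j}" for x
  proof -
    have "real (card (V - {j})) = m"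
      using jm unfolding card_parts_Diff by auto
    then show ?thesis
      using x pos by (simp add: killed_step_T)
  qed
  show "hit_V_T = 1 + killed_step H j ?f x" if x: "x \<in> V - {j}" for x
  proof -
    have c: "real (card (S - {j})) = s" "real (card (T - {j})) = t - 1"
      using jm unfolding card_parts_Diff by auto
    define e where "e = (m + s - 1) / m"
    have "hit_V_T = s + 2 * t - 1 + s * e"
      by (simp add: hit_V_T_def e_def)
    then have "hit_V_T * (s + t) = s + t + (s * (hit_V_T + e) + (t - 1) * (1 + hit_V_T))"
      by algebra
    then have "hit_V_T - 1 = (s * (hit_V_T + e) + (t - 1) * (1 + hit_V_T)) / (s + t)"
      using pos by (simp only: eq_divide_eq left_diff_distrib) simp
    then show ?thesis
      unfolding e_def[symmetric] killed_step_V[OF DiffD1[OF x]] c by linarith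
  qed
qed

text \<open>Vertices of \<open>V\<close> share their neighbourhood, so the time between two of them
  is the return time vol / (s + t) of the target, the inverse of its stationary weight.\<close>

lemma mean_first_passage_time_V:
  assumes "j \<in> V" "i \<in> pverts H - {j}"
  shows "mean_first_passage_time H i j = class_fun hit_S_V hit_T_V (vol / (s + t)) i"
proof (rule mean_first_passage_time_class_fun)
  have pos: "0 < s" "0 < m" "0 < s + m" "0 < m + s - 1" "0 < s + t"
    using s_ge_1 m_ge_1 by auto
  note jm = assms(1) disjoint_parts
  show "j \<in> pverts H" "i \<in> pverts H - {j}"
    using assms by (auto simp: pverts_eq)
  show V0: "0 \<le> vol / (s + t)"
    using pos vol_pos by (intro divide_nonneg_pos) auto
  show "0 \<le> hit_S_V" "0 \<le> hit_T_V"
    using V0 pos m_ge_1 unfolding hit_S_V_def hit_T_V_def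
    by (auto intro!: divide_nonneg_pos add_nonneg_nonneg mult_nonneg_nonneg)
  define z where "z = vol / (s + t)"
  have z: "(s + t) * z = vol"
    using pos by (simp add: z_def)
  have S: "m * hit_S_V = m + s - 1 + (m - 1) * z"
    using pos by (simp add: hit_S_V_def z_def)
  have T: "m * hit_T_V = m + (m - 1) * z"
    using pos unfolding hit_T_V_def z_def[symmetric] by (simp add: distrib_left)
  let ?f = "class_fun hit_S_V hit_T_V (vol / (s + t))"
  show "hit_S_V = 1 + killed_step H j ?f x" if x: "x \<in> S - {j}" for x
  proof -
    have c: "real (card (S - {x} - {j})) = s - 1" "real (card (V - {j})) = m - 1"
      using jm x unfolding card_parts_Diff by auto
    have "hit_S_V * (m + s - 1) = m + s - 1 + ((s - 1) * hit_S_V + (m - 1) * z)"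
      using S by algebra
    then have "hit_S_V - 1 = ((s - 1) * hit_S_V + (m - 1) * z) / (m + s - 1)"
      using pos by (simp only: eq_divide_eq left_diff_distrib) simp
    then show ?thesis
      unfolding killed_step_S[OF DiffD1[OF x]] c z_def[symmetric] by linarith
  qed
  show "hit_T_V = 1 + killed_step H j ?f x" if x: "x \<in> T - {j}" for x
  proof -
    have "real (card (V - {j})) = m - 1"
      using jm unfolding card_parts_Diff by auto
    then show ?thesis
      using x by (simp add: killed_step_T hit_T_V_def)
  qed
  show "vol / (s + t) = 1 + killed_step H j ?f x" if x: "x \<in> V - {j}" for x
  proof -
    have c: "real (card (S - {j})) = s" "real (card (T - {j})) = t"
      using jm unfolding card_parts_Diff by auto
    \<comment> \<open>The factor m makes \<open>S\<close> and \<open>T\<close> applicable, which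
      describe \<open>m * hit_S_V\<close> and \<open>m * hit_T_V\<close>.\<close>
    have "m * ((s + t) * z) = m * (s + t + s * hit_S_V + t * hit_T_V)"
      using z S T by algebra
    then have "vol = s + t + s * hit_S_V + t * hit_T_V"
      using pos by (simp add: z)
    then show ?thesis
      using x pos by (simp add: killed_step_V c field_simps)
  qed
qed

section \<open>Kemeny's constant of the graph with the clique\<close>

lemma stationary_distribution_class:
  "stationary_distribution H x = real (card {y. (x, y) \<in> parcs H}) / vol"
  by (simp add: stationary_distribution_def out_degree_with_proj card_parcs)

text \<open>For fixed \<open>i\<close> both factors depend on the target only through its class, so
  each class contributes one product times the number of its vertices other than
  \<open>i\<close>.\<close>

lemma kemeny_sum:
  assumes "i \<in> pverts H"
  shows "(\<Sum>j \<in> pverts H - {i}. stationary_distribution H j * mean_first_passage_time H i j)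
    = real (card (S - {i})) * ((m + s - 1) / vol * class_fun hit_S_S (1 + hit_V_S) hit_V_S i)
    + real (card (T - {i})) *
        (m / vol * class_fun (hit_V_T + (m + s - 1) / m) (1 + hit_V_T) hit_V_T i)
    + real (card (V - {i})) *
        ((s + t) / vol * class_fun hit_S_V hit_T_V (vol / (s + t)) i)"
proof -
  let ?g = "\<lambda>j. stationary_distribution H j * mean_first_passage_time H i j"
  have "(\<Sum>j \<in> pverts H - {i}. ?g j) = (\<Sum>j \<in> (S - {i}) \<union> (T - {i}) \<union> (V - {i}). ?g j)"
    by (rule sum.cong) (auto simp: pverts_eq)
  also have "\<dots> = (\<Sum>j \<in> S - {i}. ?g j) + (\<Sum>j \<in> T - {i}. ?g j) + (\<Sum>j \<in> V - {i}. ?g j)"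
    using finite_parts disjoint_parts
    by (subst sum.union_disjoint, simp, simp, blast)+ simp
  also have "(\<Sum>j \<in> S - {i}. ?g j)
      = (\<Sum>j \<in> S - {i}. (m + s - 1) / vol * class_fun hit_S_S (1 + hit_V_S) hit_V_S i)"
    using assms by (intro sum.cong refl)
      (auto simp: stationary_distribution_class degree_S mean_first_passage_time_S)
  also have "(\<Sum>j \<in> T - {i}. ?g j) = (\<Sum>j \<in> T - {i}.
        m / vol * class_fun (hit_V_T + (m + s - 1) / m) (1 + hit_V_T) hit_V_T i)"
    using assms by (intro sum.cong refl)
      (auto simp: stationary_distribution_class degree_T mean_first_passage_time_T)
  also have "(\<Sum>j \<in> V - {i}. ?g j)
      = (\<Sum>j \<in> V - {i}. (s + t) / vol * class_fun hit_S_V hit_T_V (vol / (s + t)) i)"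
    using assms by (intro sum.cong refl)
      (auto simp: stationary_distribution_class degree_V mean_first_passage_time_V)
  finally show ?thesis
    by simp
qed

lemma kemeny_constant_bipartite_clique:
  "kemeny_constant H
    = s + t + m - 3 - (s - 1) / (s + m) + (s + t) * (3 * m + 2 * s - 2) / vol"
proof (rule kemeny_constant_eqI)
  show "pverts H \<noteq> {}"
    using nonempty_parts by (auto simp: pverts_eq)
  fix i assume i: "i \<in> pverts H"
  have pos: "0 < s" "0 < m" "0 < s + m" "0 < m + s - 1" "0 < s + t" "0 < vol"
    using s_ge_1 m_ge_1 vol_pos by auto
  define x where "x = hit_S_S"
  define z where "z = vol / (s + t)"
  have x: "(s + m) * x = vol"
    using pos by (simp add: x_def hit_S_S_def)
  have z: "(s + t) * z = vol"
    using pos by (simp add: z_def)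
  have V_S: "s * hit_V_S = s + 2 * t + (s - 1) * x"
    using pos by (simp add: hit_V_S_def x_def)
  have V_T: "m * hit_V_T = m * (s + 2 * t - 1) + s * (m + s - 1)"
    using pos by (simp add: hit_V_T_def field_simps)
  have S_T: "m * (hit_V_T + (m + s - 1) / m) = m * hit_V_T + m + s - 1"
    using pos by (simp add: field_simps)
  have S_V: "m * hit_S_V = m + s - 1 + (m - 1) * z"
    using pos by (simp add: hit_S_V_def z_def)
  have T_V: "m * hit_T_V = m + (m - 1) * z"
    using pos unfolding hit_T_V_def z_def[symmetric] by (simp add: distrib_left)
  \<comment> \<open>Since x = vol / (s + m), this puts all terms over the common denominator
    \<open>vol\<close>.\<close>
  have x': "(s - 1) / (s + m) = (s - 1) * x / vol"
    using pos by (simp add: x_def hit_S_S_def)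
  \<comment> \<open>The bracketing of the middle term matches \<open>S_T\<close>, which later clears
    the remaining division by m.\<close>
  have distrib: "A * (p / D * a) + B * (q / D * b) + C * (r / D * c)
      = (A * p * a + B * (q * b) + C * r * c) / D" for A B C a b c p q r D :: real
    by (simp add: add_divide_distrib)
  \<comment> \<open>Leaves one polynomial identity per class of the starting vertex; the common
    right-hand side is the independence of that vertex.\<close>
  have combine: "A * ((m + s - 1) / vol * a) + B * (m / vol * b) + C * ((s + t) / vol * c)
      = s + t + m - 3 - (s - 1) / (s + m) + (s + t) * (3 * m + 2 * s - 2) / vol"
    if "A * (m + s - 1) * a + B * (m * b) + C * (s + t) * c
      = (s + t + m - 3) * vol - (s - 1) * x + (s + t) * (3 * m + 2 * s - 2)" for A B C a b c
  proof -
    have "A * ((m + s - 1) / vol * a) + B * (m / vol * b) + C * ((s + t) / vol * c)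
        = (A * (m + s - 1) * a + B * (m * b) + C * (s + t) * c) / vol"
      by (rule distrib)
    also have "\<dots> = s + t + m - 3 - (s - 1) * x / vol + (s + t) * (3 * m + 2 * s - 2) / vol"
      unfolding that using pos(6) by (simp only: add_divide_distrib diff_divide_distrib) simp
    finally show ?thesis
      by (simp only: x')
  qed
  consider (S) "i \<in> S" | (T) "i \<in> T" | (V) "i \<in> V"
    using i by (auto simp: pverts_eq)
  then show "(\<Sum>j \<in> pverts H - {i}. stationary_distribution H j * mean_first_passage_time H i j)
      = s + t + m - 3 - (s - 1) / (s + m) + (s + t) * (3 * m + 2 * s - 2) / vol"
  proof cases
    case S
    then have c: "real (card (S - {i})) = s - 1" "real (card (T - {i})) = t"
        "real (card (V - {i})) = m"
      using disjoint_parts unfolding card_parts_Diff by auto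
    show ?thesis
      unfolding kemeny_sum[OF i] c class_fun_simps(1)[OF S] x_def[symmetric]
      by (rule combine, subst S_T) (use x z V_T S_V in algebra)
  next
    case T
    then have c: "real (card (S - {i})) = s" "real (card (T - {i})) = t - 1"
        "real (card (V - {i})) = m"
      using disjoint_parts unfolding card_parts_Diff by auto
    show ?thesis
      unfolding kemeny_sum[OF i] c class_fun_simps(2)[OF T]
      by (rule combine) (use x z V_S V_T T_V in algebra)
  next
    case V
    then have c: "real (card (S - {i})) = s" "real (card (T - {i})) = t"
        "real (card (V - {i})) = m - 1"
      using disjoint_parts unfolding card_parts_Diff by auto
    show ?thesis
      unfolding kemeny_sum[OF i] c class_fun_simps(3)[OF V] z_def[symmetric]
      by (rule combine) (use x z V_S V_T in algebra)
  qed
qed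

end

section \<open>Complete bipartite graphs before and after adding the clique\<close>

lemma bipartite_clique_add_clique:
  assumes "finite (pverts G)" "pverts G = U \<union> V" "U \<inter> V = {}" "V \<noteq> {}"
    and "parcs G = U \<times> V \<union> V \<times> U" and "S \<subseteq> U" "S \<noteq> {}"
  shows "bipartite_clique (add_clique G S) S (U - S) V"
proof
  show "finite S" "finite (U - S)" "finite V"
    using assms(1,2,6) by (auto intro: finite_subset)
  show "S \<inter> (U - S) = {}" "S \<inter> V = {}" "(U - S) \<inter> V = {}"
    using assms by auto
  have "S \<union> (U - S) = U"
    using assms(6) by blast
  then show "pverts (add_clique G S) = S \<union> (U - S) \<union> V"
    and "parcs (add_clique G S) = (S \<union> (U - S)) \<times> V \<union> V \<times> (S \<union> (U - S))
      \<union> {(u, v). u \<in> S \<and> v \<in> S \<and> u \<noteq> v}"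
    using assms by (simp_all add: add_clique_def)
qed (use assms in auto)

lemma kemeny_constant_add_clique:
  assumes "finite (pverts G)" "pverts G = U \<union> V" "U \<inter> V = {}" "V \<noteq> {}"
    and "parcs G = U \<times> V \<union> V \<times> U" and "S \<subseteq> U" "S \<noteq> {}"
  defines "k \<equiv> real (card S)" and "l \<equiv> real (card U)" and "m \<equiv> real (card V)"
  shows "kemeny_constant (add_clique G S)
    = l + m - 3 - (k - 1) / (k + m) + l * (3 * m + 2 * k - 2) / (2 * m * l + k * (k - 1))"
proof -
  interpret bipartite_clique "add_clique G S" S "U - S" V
    using assms(1-7) by (rule bipartite_clique_add_clique)
  have "card U = card S + card (U - S)"
    using assms(1,2,6) by (metis card_Diff_subset card_mono finite_Un finite_subset le_add_diff_inverse)
  then have "real (card S) + real (card (U - S)) = l"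
    by (simp add: l_def)
  then show ?thesis
    using kemeny_constant_bipartite_clique by (simp add: k_def m_def)
qed

text \<open>For a one-vertex clique the two fractions in the formula become 0 and 3 / 2.\<close>

lemma kemeny_constant_complete_bipartite:
  assumes "finite (pverts G)" "pverts G = U \<union> V" "U \<inter> V = {}" "V \<noteq> {}" "U \<noteq> {}"
    and "parcs G = U \<times> V \<union> V \<times> U"
  shows "kemeny_constant G = real (card U) + real (card V) - 3 / 2"
proof -
  obtain u where u: "u \<in> U"
    using assms(5) by blast
  have no_pairs: "{(x, y). x \<in> {u} \<and> y \<in> {u} \<and> x \<noteq> y} = {}"
    by auto
  have "add_clique G {u} = G"
    unfolding add_clique_def no_pairs by simp
  moreover have "kemeny_constant (add_clique G {u}) = real (card U) + real (card V) - 3 / 2"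
  proof -
    have "real (card U) > 0" "real (card V) > 0"
      using assms(1,2,4,5) by (auto simp: card_gt_0_iff)
    then show ?thesis
      using kemeny_constant_add_clique[OF assms(1-4,6), of "{u}"] u by (simp add: field_simps)
  qed
  ultimately show ?thesis by simp
qed

section \<open>Comparison of the two constants\<close>

lemma kemeny_gap_iff:
  fixes k l m :: real
  assumes "1 < k" "0 < l" "0 < m"
  shows "l + m - 3 / 2 < l + m - 3 - (k - 1) / (k + m)
      + l * (3 * m + 2 * k - 2) / (2 * m * l + k * (k - 1))
    \<longleftrightarrow> 3 * m + 5 * k < 4 * l + 2"
proof -
  define D where "D = 2 * m * l + k * (k - 1)"
  have D: "0 < D"
    using assms by (auto simp: D_def intro!: add_pos_pos mult_pos_pos)
  have "(k - 1) / (k + m) + 3 / 2 = (3 * m + 5 * k - 2) / (2 * (k + m))"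
    using assms by (simp add: field_simps)
  then have "l + m - 3 - (k - 1) / (k + m) + l * (3 * m + 2 * k - 2) / D - (l + m - 3 / 2)
      = l * (3 * m + 2 * k - 2) / D - (3 * m + 5 * k - 2) / (2 * (k + m))"
    by linarith
  also have "\<dots> = (2 * (k + m) * (l * (3 * m + 2 * k - 2)) - (3 * m + 5 * k - 2) * D) / (2 * (k + m) * D)"
    using assms D by (subst diff_frac_eq) (auto simp: mult_ac)
  \<comment> \<open>The coefficient of l collapses to 4 k (k - 1), so that k (k - 1) factors
    out.\<close>
  also have "2 * (k + m) * (l * (3 * m + 2 * k - 2)) - (3 * m + 5 * k - 2) * D
      = k * (k - 1) * (4 * l + 2 - (3 * m + 5 * k))"
    unfolding D_def by algebra
  finally have eq: "l + m - 3 - (k - 1) / (k + m) + l * (3 * m + 2 * k - 2) / D - (l + m - 3 / 2)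
      = k * (k - 1) / (2 * (k + m) * D) * (4 * l + 2 - (3 * m + 5 * k))"
    by simp
  \<comment> \<open>Strict because k > 1; hence the linear factor alone decides the sign.\<close>
  have "0 < k * (k - 1) / (2 * (k + m) * D)"
    using assms D by simp
  then have "0 < k * (k - 1) / (2 * (k + m) * D) * (4 * l + 2 - (3 * m + 5 * k))
      \<longleftrightarrow> 3 * m + 5 * k < 4 * l + 2"
    by (simp only: zero_less_mult_iff) auto
  then show ?thesis
    unfolding D_def[symmetric] eq[symmetric] by linarith
qed

section \<open>Connectedness and identification of the parts\<close>

text \<open>Vertices in different parts are adjacent, and vertices in the same part have a common
  neighbour in the other one.\<close>

lemma connected_complete_bipartite:
  assumes "pair_graph G" "pverts G = U \<union> V" "U \<noteq> {}" "V \<noteq> {}"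
    and "parcs G = U \<times> V \<union> V \<times> U"
  shows "connected (with_proj G)"
proof -
  interpret pair_graph G by fact
  have reach: "x \<rightarrow>\<^sup>*\<^bsub>with_proj G\<^esub> y" if xy: "x \<in> pverts G" "y \<in> pverts G" for x y
  proof -
    obtain u v where "u \<in> U" "v \<in> V"
      using assms(3,4) by blast
    then consider "(x, y) \<in> parcs G"
      | w where "(x, w) \<in> parcs G" "(w, y) \<in> parcs G"
      using xy unfolding assms(2,5) by blast
    then show ?thesis
      by cases (auto intro: reachable_trans)
  qed
  show ?thesis
    unfolding connected_def
    using assms(2,3) by (intro strongly_connectedI reachable_mk_symmetricI reach) auto
qed

text \<open>Matches a given bipartition with the parts supplied by the library predicate: the side
  of one vertex \<open>a\<close> decides the side of all of \<open>B\<close>, and then of all of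
  \<open>A\<close>.\<close>

lemma complete_bipartite_bipartition:
  assumes "pverts G = A \<union> B" "A \<inter> B = {}" "A \<noteq> {}" "B \<noteq> {}"
    and "parcs G = A \<times> B \<union> B \<times> A" and "bipartition G U V"
  shows "U = A \<and> V = B \<or> U = B \<and> V = A"
proof -
  have UV: "A \<union> B = U \<union> V" "U \<inter> V = {}"
    and arcs: "\<And>a b. a \<in> A \<Longrightarrow> b \<in> B \<Longrightarrow> a \<in> U \<and> b \<in> V \<or> a \<in> V \<and> b \<in> U"
    using assms by (auto simp: bipartition_def)
  obtain a b where ab: "a \<in> A" "b \<in> B"
    using assms(3,4) by blast
  show ?thesis
  proof (cases "a \<in> U")
    case True
    then have "B \<subseteq> V"
      using arcs[OF ab(1)] UV by blast
    moreover from this have "A \<subseteq> U"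
      using arcs[OF _ ab(2)] ab UV by blast
    ultimately show ?thesis
      using UV by blast
  next
    case False
    then have "B \<subseteq> U"
      using arcs[OF ab(1)] UV by blast
    moreover from this have "A \<subseteq> V"
      using arcs[OF _ ab(2)] ab UV by blast
    ultimately show ?thesis
      using UV by blast
  qed
qed

theorem theorem4p7:
  fixes G :: "'a pair_pre_digraph" and U V :: "'a set" and l n k :: nat
  assumes "2 \<le> l" and "l \<le> n - 1"
    and "2 \<le> k" and "k \<le> l"
    and "complete_bipartite_digraph l (n - l) (with_proj G)"
    and "bipartition G U V" and "card U = l"
  shows "(\<exists>S. S \<subseteq> U \<and> braess_clique G k S)
           \<longleftrightarrow> real k < (7 * real l - 3 * real n + 2) / 5"
proof -
  obtain A B where AB: "finite (pverts G)" "pverts G = A \<union> B" "A \<inter> B = {}"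
      "card A = l" "card B = n - l" "parcs G = A \<times> B \<union> B \<times> A"
    using assms(5) unfolding complete_bipartite_digraph_pair_def by (elim conjE exE)
  have "A \<noteq> {}" "B \<noteq> {}"
    using AB(4,5) assms(1,2) by auto
  then have "U = A \<and> V = B \<or> U = B \<and> V = A"
    using AB assms(6) by (intro complete_bipartite_bipartition) auto
  \<comment> \<open>If the parts are swapped, \<open>card U = l\<close> forces l = n - l, so
    \<open>V\<close> has n - l vertices in either case.\<close>
  then have UV: "pverts G = U \<union> V" "U \<inter> V = {}" "V \<noteq> {}" "U \<noteq> {}"
      "parcs G = U \<times> V \<union> V \<times> U" and card_V: "card V = n - l"
    using AB assms(7) \<open>A \<noteq> {}\<close> \<open>B \<noteq> {}\<close> by auto
  have pg: "pair_graph G"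
    using assms(5) by (rule pair_graphI_complete_bipartite)
  \<comment> \<open>The natural subtraction is exact and positive, since 2 \<le> l \<le> n - 1 gives
    l < n.\<close>
  have m: "real (card V) = real n - real l" "0 < real (card V)"
    using card_V assms(1,2) by auto
  \<comment> \<open>The criterion depends on \<open>S\<close> only through its size, so one
    equivalence serves both directions.\<close>
  have kemeny: "kemeny_constant G < kemeny_constant (add_clique G S)
      \<longleftrightarrow> real k < (7 * real l - 3 * real n + 2) / 5" if "S \<subseteq> U" "card S = k" for S
  proof -
    have "S \<noteq> {}"
      using that assms(3) by auto
    then have "kemeny_constant G < kemeny_constant (add_clique G S)
        \<longleftrightarrow> 3 * real (card V) + 5 * real k < 4 * real l + 2"
      using kemeny_gap_iff[of "real k" "real l" "real (card V)"] assms(1,3) m(2) that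
      by (simp add: kemeny_constant_add_clique[OF AB(1) UV(1-3,5)]
          kemeny_constant_complete_bipartite[OF AB(1) UV] assms(7))
    then show ?thesis
      using m(1) by (simp add: field_simps)
  qed
  show ?thesis
  proof
    assume "real k < (7 * real l - 3 * real n + 2) / 5"
    moreover obtain S where S: "S \<subseteq> U" "card S = k"
      using assms(4,7) by (metis obtain_subset_with_card_n)
    moreover have "independent_set G S"
      using S UV(1,2,5) by (auto simp: independent_set_def)
    ultimately show "\<exists>S. S \<subseteq> U \<and> braess_clique G k S"
      using kemeny[OF S] pg connected_complete_bipartite[OF pg UV(1,4,3,5)]
      by (auto simp: braess_clique_def)
  qed (auto simp: braess_clique_def kemeny)
qed

end
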